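(* Let $(\mathcal{A},\cdot)$ be a left-symmetric algebra over $\mathbb{K}$, with left multiplication operators $\mathrm{L}_u(v)=u\cdot v$. Then the vector space $T^*(\mathcal{A})=\mathcal{A}\oplus\mathcal{A}^*$ endowed with the bracket $$[u+f,\,v+g]=(u\cdot v-v\cdot u)+\mathrm{L}_u^*(g)-\mathrm{L}_v^*(f),\qquad u,v\in\mathcal{A},\ f,g\in\mathcal{A}^*,$$ is a Lie algebra. Moreover, the bilinear form $\omega_c:T^*(\mathcal{A})\times T^*(\mathcal{A})\to\mathbb{K}$ defined by $\omega_c(u+f,v+g)=f(v)-g(u)$ is skew-symmetric, nondegenerate, and a $2$-cocycle on the Lie algebra $(T^*(\mathcal{A}),[\cdot,\cdot])$. Consequently $(T^*(\mathcal{A}),[\cdot,\cdot],\omega_c)$ is a symplectic Lie algebra.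
   Context: $\mathbb{K}$ is a field of characteristic $0$; all vector spaces are finite-dimensional. $(\mathcal{A},\cdot)$ is left-symmetric if $(u\cdot v)\cdot w-u\cdot(v\cdot w)=(v\cdot u)\cdot w-v\cdot(u\cdot w)$ for all $u,v,w$. The dual operator is $\mathrm{L}_u^*(f)=-f\circ\mathrm{L}_u$ for $f\in\mathcal{A}^*$. A skew-symmetric bilinear form $\omega$ on a Lie algebra is a $2$-cocycle if $\omega([x,y],z)+\omega([y,z],x)+\omega([z,x],y)=0$ for all $x,y,z$. A symplectic Lie algebra is a Lie algebra with a nondegenerate skew-symmetric $2$-cocycle. *)

theory Defs
  imports "HOL-Analysis.Product_Vector" "HOL-Library.Function_Algebras"
begin

text \<open>
  The dual space depends on the scalar multiplication and is therefore a subset of the type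
  of all functions, with the pointwise operations.  For this reason Lie algebras live on a
  subspace of an ambient vector space.  All vector spaces are finite-dimensional over a field
  of characteristic 0.
\<close>

definition bilinear_on ::
  "('k \<Rightarrow> 'v \<Rightarrow> 'v) \<Rightarrow> ('k \<Rightarrow> 'w \<Rightarrow> 'w) \<Rightarrow> 'v set \<Rightarrow> ('v::plus \<Rightarrow> 'v \<Rightarrow> 'w::plus) \<Rightarrow> bool"
  where "bilinear_on s t V b \<longleftrightarrow>
    (\<forall>x\<in>V. \<forall>y\<in>V. \<forall>z\<in>V. b (x + y) z = b x z + b y z \<and> b x (y + z) = b x y + b x z) \<and>
    (\<forall>c. \<forall>x\<in>V. \<forall>y\<in>V. b (s c x) y = t c (b x y) \<and> b x (s c y) = t c (b x y))"

definition (in vector_space) finite_dim_subspace :: "'b set \<Rightarrow> bool"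
  where "finite_dim_subspace V \<longleftrightarrow> subspace V \<and> (\<exists>B. finite B \<and> V = span B)"


locale left_symmetric_algebra = vector_space scale
  for scale :: "'k::field_char_0 \<Rightarrow> 'a::ab_group_add \<Rightarrow> 'a" +
  fixes mult :: "'a \<Rightarrow> 'a \<Rightarrow> 'a"
  assumes finite_dim: "finite_dim_subspace UNIV"
    and mult_bilinear: "bilinear_on scale scale UNIV mult"
    and left_symmetric:
      "mult (mult u v) w - mult u (mult v w) = mult (mult v u) w - mult v (mult u w)"

locale lie_algebra = vector_space scale
  for scale :: "'k::field_char_0 \<Rightarrow> 'v::ab_group_add \<Rightarrow> 'v" +
  fixes L :: "'v set" and bracket :: "'v \<Rightarrow> 'v \<Rightarrow> 'v"
  assumes finite_dim: "finite_dim_subspace L"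
    and bracket_closed: "\<lbrakk>x \<in> L; y \<in> L\<rbrakk> \<Longrightarrow> bracket x y \<in> L"
    and bracket_bilinear: "bilinear_on scale scale L bracket"
    and bracket_alternating: "x \<in> L \<Longrightarrow> bracket x x = 0"
    and jacobi: "\<lbrakk>x \<in> L; y \<in> L; z \<in> L\<rbrakk> \<Longrightarrow>
      bracket x (bracket y z) + bracket y (bracket z x) + bracket z (bracket x y) = 0"


definition skew_symmetric_on :: "'v set \<Rightarrow> ('v \<Rightarrow> 'v \<Rightarrow> 'k::uminus) \<Rightarrow> bool"
  where "skew_symmetric_on V \<omega> \<longleftrightarrow> (\<forall>x\<in>V. \<forall>y\<in>V. \<omega> x y = - \<omega> y x)"

definition nondegenerate_on :: "'v::zero set \<Rightarrow> ('v \<Rightarrow> 'v \<Rightarrow> 'k::zero) \<Rightarrow> bool"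
  where "nondegenerate_on V \<omega> \<longleftrightarrow>
    (\<forall>x\<in>V. (\<forall>y\<in>V. \<omega> x y = 0) \<longrightarrow> x = 0) \<and>
    (\<forall>y\<in>V. (\<forall>x\<in>V. \<omega> x y = 0) \<longrightarrow> y = 0)"

definition two_cocycle_on ::
  "'v set \<Rightarrow> ('v \<Rightarrow> 'v \<Rightarrow> 'v) \<Rightarrow> ('v \<Rightarrow> 'v \<Rightarrow> 'k::{plus,zero}) \<Rightarrow> bool"
  where "two_cocycle_on L bracket \<omega> \<longleftrightarrow>
    (\<forall>x\<in>L. \<forall>y\<in>L. \<forall>z\<in>L.
      \<omega> (bracket x y) z + \<omega> (bracket y z) x + \<omega> (bracket z x) y = 0)"

locale symplectic_lie_algebra = lie_algebra scale L bracket
  for scale :: "'k::field_char_0 \<Rightarrow> 'v::ab_group_add \<Rightarrow> 'v" and L bracket +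
  fixes \<omega> :: "'v \<Rightarrow> 'v \<Rightarrow> 'k"
  assumes form_bilinear: "bilinear_on scale (*) L \<omega>"
    and form_skew_symmetric: "skew_symmetric_on L \<omega>"
    and form_nondegenerate: "nondegenerate_on L \<omega>"
    and form_cocycle: "two_cocycle_on L bracket \<omega>"


definition dual_space :: "('k::field \<Rightarrow> 'a::ab_group_add \<Rightarrow> 'a) \<Rightarrow> ('a \<Rightarrow> 'k) set"
  where "dual_space s = {f. Vector_Spaces.linear s (*) f}"

definition dual_scale :: "'k::field \<Rightarrow> ('a \<Rightarrow> 'k) \<Rightarrow> ('a \<Rightarrow> 'k)"
  where "dual_scale c f = (\<lambda>v. c * f v)"

definition dual_op :: "('a \<Rightarrow> 'a) \<Rightarrow> ('a \<Rightarrow> 'k::field) \<Rightarrow> ('a \<Rightarrow> 'k)"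
  where "dual_op T f = - (f \<circ> T)"


text \<open>The pair \<open>(u, f)\<close> stands for \<open>u + f\<close>.\<close>

definition cotangent_space ::
  "('k::field \<Rightarrow> 'a::ab_group_add \<Rightarrow> 'a) \<Rightarrow> ('a \<times> ('a \<Rightarrow> 'k)) set"
  where "cotangent_space s = UNIV \<times> dual_space s"

definition cotangent_scale ::
  "('k::field \<Rightarrow> 'a::ab_group_add \<Rightarrow> 'a) \<Rightarrow> 'k \<Rightarrow> 'a \<times> ('a \<Rightarrow> 'k) \<Rightarrow> 'a \<times> ('a \<Rightarrow> 'k)"
  where "cotangent_scale s = module_prod.scale s dual_scale"

definition cotangent_bracket ::
  "('a::ab_group_add \<Rightarrow> 'a \<Rightarrow> 'a) \<Rightarrow>
    'a \<times> ('a \<Rightarrow> 'k::field) \<Rightarrow> 'a \<times> ('a \<Rightarrow> 'k) \<Rightarrow> 'a \<times> ('a \<Rightarrow> 'k)"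
  where "cotangent_bracket mult = (\<lambda>(u, f) (v, g).
    (mult u v - mult v u, dual_op (mult u) g - dual_op (mult v) f))"

definition cotangent_form ::
  "'a \<times> ('a \<Rightarrow> 'k::field) \<Rightarrow> 'a \<times> ('a \<Rightarrow> 'k) \<Rightarrow> 'k"
  where "cotangent_form = (\<lambda>(u, f) (v, g). f v - g u)"

end

theory Submission
  imports Defs
begin

text \<open>
  Write \<open>[u, v] = u \<cdot> v - v \<cdot> u\<close>.  Left symmetry, rearranged, reads
  \<open>L\<^bsub>[u, v]\<^esub> = L\<^sub>u L\<^sub>v - L\<^sub>v L\<^sub>u\<close>.  This identity does all the algebraic work.  It gives the
  Jacobi identity of the commutator on \<open>\<A>\<close> (\<open>commutator_jacobi\<close>), and, after dualising, it says
  that \<open>u \<mapsto> L\<^sub>u\<^sup>*\<close> is a representation of that Lie algebra on the dual space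
  (\<open>dual_op_commutator\<close>).  The bracket on \<open>T\<^sup>*(\<A>)\<close> is the semidirect product of the commutator
  Lie algebra with this representation, so its Jacobi identity splits: the first component is the
  Jacobi identity of the commutator, and in the second the terms in each covector cancel by the
  representation property.

  The form is the canonical pairing of \<open>\<A>\<close> with its dual, made skew.  It is
  nondegenerate because covectors separate the points of a vector space
  (\<open>dual_space_separates_points\<close>).  In the cocycle identity the expression
  \<open>\<omega>([u + f, v + g], w + h) = f(v \<cdot> w) - g(u \<cdot> w) - h(u \<cdot> v) + h(v \<cdot> u)\<close> is summed cyclically; each
  covector then meets each product of the other two vectors twice, with opposite signs.
  The space \<open>T\<^sup>*(\<A>)\<close> is finite-dimensional because the dual basis spans the dual space.
\<close>

section \<open>The dual of a finite-dimensional vector space\<close>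

lemma vector_space_dual_scale: "vector_space dual_scale"
  by unfold_locales (auto simp: dual_scale_def fun_eq_iff algebra_simps)

context vector_space
begin

lemma dual_space_add: "f \<in> dual_space scale \<Longrightarrow> f (u + v) = f u + f v"
  and dual_space_diff: "f \<in> dual_space scale \<Longrightarrow> f (u - v) = f u - f v"
  and dual_space_zero: "f \<in> dual_space scale \<Longrightarrow> f 0 = 0"
  and dual_space_scale: "f \<in> dual_space scale \<Longrightarrow> f (scale c u) = c * f u"
  by (auto simp: dual_space_def dest: module_hom.add[OF Vector_Spaces.linear.axioms(3)]
      module_hom.diff[OF Vector_Spaces.linear.axioms(3)]
      module_hom.zero[OF Vector_Spaces.linear.axioms(3)]
      module_hom.scale[OF Vector_Spaces.linear.axioms(3)])

lemma dual_spaceI: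
  assumes "\<And>u v. f (u + v) = f u + f v" "\<And>c u. f (scale c u) = c * f u"
  shows "f \<in> dual_space scale"
proof -
  have "vector_space ((*) :: 'a \<Rightarrow> 'a \<Rightarrow> 'a)"
    by unfold_locales (auto simp: algebra_simps)
  then show ?thesis
    using assms vector_space_axioms by (simp add: dual_space_def Vector_Spaces.linear_iff)
qed

lemma subspace_dual_space: "module.subspace dual_scale (dual_space scale)"
proof -
  interpret dual: vector_space dual_scale by (rule vector_space_dual_scale)
  show ?thesis
    by (rule dual.subspaceI)
      (auto intro!: dual_spaceI
        simp: dual_space_add dual_space_scale dual_scale_def algebra_simps)
qed

lemma finite_basis_exists:
  assumes "finite_dim_subspace UNIV"
  obtains B where "finite B" "independent B" "span B = UNIV"
proof -
  obtain C where C: "finite C" "span C = UNIV"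
    using assms unfolding finite_dim_subspace_def by metis
  obtain B where B: "B \<subseteq> C" "independent B" "C \<subseteq> span B"
    using maximal_independent_subset[of C] by blast
  have "finite B" using B C finite_subset by blast
  moreover have "span B = UNIV" using B C span_minimal[OF _ subspace_span, of C B] by blast
  ultimately show thesis using B that by blast
qed

lemma representation_in_dual_space:
  assumes "independent B" "span B = UNIV"
  shows "(\<lambda>v. representation B v b) \<in> dual_space scale"
  using assms by (intro dual_spaceI) (simp_all add: representation_add representation_scale)

text \<open>A covector is the combination of the coordinate functions whose coefficients are its values
  on the basis, so finitely many coordinate functions span the dual space.\<close>

lemma finite_dim_dual_space:
  assumes "finite_dim_subspace UNIV"
  shows "vector_space.finite_dim_subspace dual_scale (dual_space scale)"
proof -
  interpret dual: vector_space dual_scale by (rule vector_space_dual_scale)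
  obtain B where B: "finite B" "independent B" "span B = UNIV"
    using assms by (rule finite_basis_exists)
  define coord where "coord b = (\<lambda>v. representation B v b)" for b
  have "dual_space scale \<subseteq> dual.span (coord ` B)"
  proof
    fix f assume f: "f \<in> dual_space scale"
    have sum_eval: "sum g A v = (\<Sum>b\<in>A. g b v)" for g :: "'b \<Rightarrow> 'b \<Rightarrow> 'a" and A v
      by (induction A rule: infinite_finite_induct) auto
    have f_sum: "f (sum g A) = (\<Sum>b\<in>A. f (g b))" for g :: "'b \<Rightarrow> 'b" and A
      by (induction A rule: infinite_finite_induct)
        (auto simp: dual_space_add[OF f] dual_space_zero[OF f])
    have "f v = (\<Sum>b\<in>B. dual_scale (f b) (coord b)) v" for v
    proof -
      have "f v = f (\<Sum>b\<in>B. scale (representation B v b) b)"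
        using B by (simp add: sum_representation_eq)
      also have "\<dots> = (\<Sum>b\<in>B. dual_scale (f b) (coord b)) v"
        by (simp add: f_sum sum_eval dual_space_scale[OF f] dual_scale_def coord_def mult.commute)
      finally show ?thesis .
    qed
    then have "f = (\<Sum>b\<in>B. dual_scale (f b) (coord b))" by blast
    also have "\<dots> \<in> dual.span (coord ` B)"
      by (intro dual.span_sum dual.span_scale dual.span_base) auto
    finally show "f \<in> dual.span (coord ` B)" .
  qed
  moreover have "dual.span (coord ` B) \<subseteq> dual_space scale"
    using B by (intro dual.span_minimal subspace_dual_space)
      (auto simp: coord_def representation_in_dual_space)
  ultimately show ?thesis
    using B subspace_dual_space unfolding dual.finite_dim_subspace_def by blast
qed

text \<open>The coordinates of a vector in a basis are values of covectors, and they determine it.\<close>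

lemma dual_space_separates_points:
  assumes "\<And>f. f \<in> dual_space scale \<Longrightarrow> f u = 0"
  shows "u = 0"
proof -
  obtain B where B: "independent B" "span B = UNIV"
    using maximal_independent_subset[of UNIV] by (metis top.extremum_uniqueI)
  then have "representation B u b = 0" for b
    using assms representation_in_dual_space by blast
  then show ?thesis
    using sum_nonzero_representation_eq[of B u] B by simp
qed

end

lemma (in vector_space_prod) finite_dim_subspace_Times:
  assumes "vs1.finite_dim_subspace V" "vs2.finite_dim_subspace W"
  shows "p.finite_dim_subspace (V \<times> W)"
proof -
  obtain B C where B: "finite B" "V = vs1.span B" and C: "finite C" "W = vs2.span C"
    using assms unfolding vs1.finite_dim_subspace_def vs2.finite_dim_subspace_def by auto
  let ?D = "(\<lambda>b. (b, 0)) ` B \<union> Pair 0 ` C"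
  have sub: "p.subspace (V \<times> W)"
    using assms subspace_Times
    unfolding vs1.finite_dim_subspace_def vs2.finite_dim_subspace_def by blast
  have left: "(u, 0) \<in> p.span ?D" if "u \<in> vs1.span B" for u
    using that
  proof (induction rule: vs1.span_induct_alt)
    case base
    show ?case using p.span_zero[of ?D] by (simp add: zero_prod_def)
  next
    case (step c x y)
    then have "scale c (x, 0) + (y, 0) \<in> p.span ?D"
      by (intro p.span_add p.span_scale) (auto intro: p.span_base)
    then show ?case by (simp add: scale_prod)
  qed
  have right: "(0, w) \<in> p.span ?D" if "w \<in> vs2.span C" for w
    using that
  proof (induction rule: vs2.span_induct_alt)
    case base
    show ?case using p.span_zero[of ?D] by (simp add: zero_prod_def)
  next
    case (step c x y)
    then have "scale c (0, x) + (0, y) \<in> p.span ?D"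
      by (intro p.span_add p.span_scale) (auto intro: p.span_base)
    then show ?case by (simp add: scale_prod)
  qed
  have "V \<times> W \<subseteq> p.span ?D"
  proof
    fix x assume "x \<in> V \<times> W"
    then have "(fst x, 0) + (0, snd x) \<in> p.span ?D"
      using B C by (intro p.span_add left right) auto
    then show "x \<in> p.span ?D" by simp
  qed
  moreover have "p.span ?D \<subseteq> V \<times> W"
    using assms B C sub by (intro p.span_minimal)
      (auto intro: vs1.span_base vs2.span_base vs1.span_zero vs2.span_zero)
  ultimately show ?thesis
    using B C sub unfolding p.finite_dim_subspace_def
    by (intro conjI exI[of _ ?D]) auto
qed

section \<open>The commutator Lie algebra and its action on covectors\<close>

lemma dual_op_apply [simp]: "dual_op T f v = - f (T v)"
  by (simp add: dual_op_def)

lemma dual_op_diff: "dual_op T (f - g) = dual_op T f - dual_op T g"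
  by (simp add: fun_eq_iff)

context left_symmetric_algebra
begin

lemma mult_add_left: "mult (u + v) w = mult u w + mult v w"
  and mult_add_right: "mult u (v + w) = mult u v + mult u w"
  and mult_scale_left: "mult (scale c u) v = scale c (mult u v)"
  and mult_scale_right: "mult u (scale c v) = scale c (mult u v)"
  using mult_bilinear by (auto simp: bilinear_on_def)

lemma mult_diff_left: "mult (u - v) w = mult u w - mult v w"
  using mult_add_left[of "u - v" v w] by (simp add: algebra_simps)

lemma mult_diff_right: "mult u (v - w) = mult u v - mult u w"
  using mult_add_right[of u "v - w" w] by (simp add: algebra_simps)

lemmas mult_linear_simps = mult_add_left mult_add_right mult_diff_left mult_diff_right
  mult_scale_left mult_scale_right

lemma mult_commutator:
  "mult (mult u v - mult v u) w = mult u (mult v w) - mult v (mult u w)"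
  using left_symmetric[of u v w] by (simp add: mult_diff_left algebra_simps)

abbreviation commutator :: "'a \<Rightarrow> 'a \<Rightarrow> 'a"
  where "commutator u v \<equiv> mult u v - mult v u"

lemma commutator_jacobi:
  "commutator u (commutator v w) + commutator v (commutator w u) + commutator w (commutator u v)
    = 0"
  unfolding mult_commutator mult_diff_right by (simp add: algebra_simps)

lemma dual_op_in_dual_space:
  "f \<in> dual_space scale \<Longrightarrow> dual_op (mult u) f \<in> dual_space scale"
  by (rule dual_spaceI)
    (simp_all add: mult_linear_simps dual_space_add dual_space_scale)

text \<open>Dualising reverses the order of composition, and the two signs cancel in a product of two
  dual operators; the sign of the single dual operator on the left undoes the reversal.\<close>

lemma dual_op_commutator:
  assumes "f \<in> dual_space scale"
  shows "dual_op (mult (commutator u v)) f =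
    dual_op (mult u) (dual_op (mult v) f) - dual_op (mult v) (dual_op (mult u) f)"
  by (simp add: fun_eq_iff mult_commutator dual_space_diff[OF assms])

section \<open>The symplectic Lie algebra on the cotangent space\<close>

lemma vector_space_prod_dual: "vector_space_prod scale dual_scale"
  by (intro vector_space_prod.intro vector_space_pair.intro vector_space_axioms
      vector_space_dual_scale)

lemma cotangent_scale_Pair: "cotangent_scale scale c (u, f) = (scale c u, dual_scale c f)"
proof -
  interpret vector_space_prod scale dual_scale by (rule vector_space_prod_dual)
  show ?thesis unfolding cotangent_scale_def by (rule scale_prod)
qed

lemma cotangent_bracket_Pair:
  "cotangent_bracket mult (u, f) (v, g) =
    (commutator u v, dual_op (mult u) g - dual_op (mult v) f)"
  by (simp add: cotangent_bracket_def)

lemma cotangent_form_Pair: "cotangent_form (u, f) (v, g) = f v - g u"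
  by (simp add: cotangent_form_def)

lemma cotangent_jacobi:
  assumes "x \<in> cotangent_space scale" "y \<in> cotangent_space scale" "z \<in> cotangent_space scale"
  shows "cotangent_bracket mult x (cotangent_bracket mult y z)
    + cotangent_bracket mult y (cotangent_bracket mult z x)
    + cotangent_bracket mult z (cotangent_bracket mult x y) = 0"
proof -
  obtain u f v g w h where xyz: "x = (u, f)" "y = (v, g)" "z = (w, h)"
    by (metis surj_pair)
  have "f \<in> dual_space scale" "g \<in> dual_space scale" "h \<in> dual_space scale"
    using assms by (auto simp: xyz cotangent_space_def)
  then show ?thesis
    unfolding xyz cotangent_bracket_Pair
    by (simp only: add_Pair commutator_jacobi dual_op_commutator dual_op_diff)
      (simp add: zero_prod_def)
qed

lemma bilinear_on_cotangent_bracket: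
  "bilinear_on (cotangent_scale scale) (cotangent_scale scale) (cotangent_space scale)
    (cotangent_bracket mult)"
  by (auto simp: bilinear_on_def cotangent_space_def cotangent_scale_Pair cotangent_bracket_Pair
      mult_linear_simps scale_right_diff_distrib dual_scale_def fun_eq_iff
      dual_space_add dual_space_scale algebra_simps)

lemma lie_algebra_cotangent:
  "lie_algebra (cotangent_scale scale) (cotangent_space scale) (cotangent_bracket mult)"
proof -
  interpret vector_space_prod scale dual_scale by (rule vector_space_prod_dual)
  interpret cot: vector_space "cotangent_scale scale"
    unfolding cotangent_scale_def by (rule p.vector_space_axioms)
  interpret dual: vector_space dual_scale by (rule vector_space_dual_scale)
  show ?thesis
  proof
    show "cot.finite_dim_subspace (cotangent_space scale)"
      using finite_dim_subspace_Times[OF finite_dim finite_dim_dual_space[OF finite_dim]]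
      by (simp add: cotangent_space_def cotangent_scale_def)
  next
    fix x y assume "x \<in> cotangent_space scale" "y \<in> cotangent_space scale"
    then show "cotangent_bracket mult x y \<in> cotangent_space scale"
      by (auto simp: cotangent_space_def cotangent_bracket_Pair
          intro!: dual.subspace_diff subspace_dual_space dual_op_in_dual_space)
  next
    fix x
    show "cotangent_bracket mult x x = 0"
      by (cases x) (simp add: cotangent_bracket_Pair zero_prod_def)
  qed (rule bilinear_on_cotangent_bracket, rule cotangent_jacobi)
qed

lemma bilinear_on_cotangent_form:
  "bilinear_on (cotangent_scale scale) (*) (cotangent_space scale) cotangent_form"
  by (auto simp: bilinear_on_def cotangent_space_def cotangent_scale_Pair cotangent_form_Pair
      dual_scale_def dual_space_add dual_space_scale algebra_simps)

lemma skew_symmetric_on_cotangent_form: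
  "skew_symmetric_on (cotangent_space scale) cotangent_form"
  by (auto simp: skew_symmetric_on_def cotangent_form_Pair)

lemma nondegenerate_on_cotangent_form:
  "nondegenerate_on (cotangent_space scale) cotangent_form"
proof -
  let ?T = "cotangent_space scale"
  have left: "x = 0" if x: "x \<in> ?T" and 0: "\<And>y. y \<in> ?T \<Longrightarrow> cotangent_form x y = 0" for x
  proof -
    obtain u f where uf: "x = (u, f)" by (cases x)
    have f: "f \<in> dual_space scale" using x by (simp add: uf cotangent_space_def)
    have zero: "0 \<in> dual_space scale" by (rule dual_spaceI) auto
    have "f v = 0" for v
      using 0[of "(v, 0)"] zero by (simp add: uf cotangent_space_def cotangent_form_Pair)
    moreover have "u = 0"
    proof (rule dual_space_separates_points)
      fix g assume "g \<in> dual_space scale"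
      then show "g u = 0"
        using 0[of "(0, g)"] dual_space_zero[OF f]
        by (simp add: uf cotangent_space_def cotangent_form_Pair)
    qed
    ultimately show "x = 0" by (simp add: uf zero_prod_def fun_eq_iff)
  qed
  have "cotangent_form x y = 0 \<longleftrightarrow> cotangent_form y x = 0" for x y :: "'a \<times> ('a \<Rightarrow> 'k)"
    by (cases x; cases y) (auto simp: cotangent_form_Pair)
  then show ?thesis
    using left unfolding nondegenerate_on_def by blast
qed

lemma two_cocycle_on_cotangent_form:
  "two_cocycle_on (cotangent_space scale) (cotangent_bracket mult) cotangent_form"
  by (auto simp: two_cocycle_on_def cotangent_space_def cotangent_bracket_Pair
      cotangent_form_Pair dual_space_diff)

lemma symplectic_lie_algebra_cotangent:
  "symplectic_lie_algebra (cotangent_scale scale) (cotangent_space scale)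
    (cotangent_bracket mult) cotangent_form"
  by (intro symplectic_lie_algebra.intro symplectic_lie_algebra_axioms.intro
      lie_algebra_cotangent bilinear_on_cotangent_form skew_symmetric_on_cotangent_form
      nondegenerate_on_cotangent_form two_cocycle_on_cotangent_form)

end

theorem theorem3p9:
  fixes s :: "'k::field_char_0 \<Rightarrow> 'a::ab_group_add \<Rightarrow> 'a"
    and mult :: "'a \<Rightarrow> 'a \<Rightarrow> 'a"
  assumes "left_symmetric_algebra s mult"
  shows "lie_algebra (cotangent_scale s) (cotangent_space s) (cotangent_bracket mult) \<and>
    bilinear_on (cotangent_scale s) (*) (cotangent_space s) cotangent_form \<and>
    skew_symmetric_on (cotangent_space s) cotangent_form \<and>
    nondegenerate_on (cotangent_space s) cotangent_form \<and>
    two_cocycle_on (cotangent_space s) (cotangent_bracket mult) cotangent_form \<and>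
    symplectic_lie_algebra (cotangent_scale s) (cotangent_space s)
      (cotangent_bracket mult) cotangent_form"
  using assms by (intro conjI left_symmetric_algebra.lie_algebra_cotangent
      left_symmetric_algebra.bilinear_on_cotangent_form
      left_symmetric_algebra.skew_symmetric_on_cotangent_form
      left_symmetric_algebra.nondegenerate_on_cotangent_form
      left_symmetric_algebra.two_cocycle_on_cotangent_form
      left_symmetric_algebra.symplectic_lie_algebra_cotangent)

end
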